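(* Given independent random variables $X_1,\ldots,X_n$, each with an arbitrary two-point distribution, there exists an algorithm that finds an ordering $\sigma$ maximizing $V_\sigma$ (an optimal ordering for optimal stopping) in $O(n^2)$ time.
   Context: A two-point distribution for $X_i$ is given by parameters $a_i\le b_i$ and $p_i\in[0,1]$: $X_i=a_i$ with probability $1-p_i$ and $X_i=b_i$ with probability $p_i$. For a permutation $\sigma$ of $\{1,\ldots,n\}$, a player observes $X_{\sigma(1)},X_{\sigma(2)},\ldots$ in order, and after each observation may stop and receive the observed value or continue; if she never stops she receives $0$. $V_\sigma$ is the maximum expected reward over stopping rules: $V_\sigma(n+1)=0$, $V_\sigma(j)=E[\max(X_{\sigma(j)},V_\sigma(j+1))]$, $V_\sigma:=V_\sigma(1)$. *)

theory Defs
  imports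
    "HOL-Probability.Probability"
    "HOL-Library.Landau_Symbols"
    "HOL-Combinatorics.Permutations"
begin

section \<open>Optimal stopping with two-point distributions\<close>

definition two_point_pmf :: "real \<Rightarrow> real \<Rightarrow> real \<Rightarrow> real pmf" where
  "two_point_pmf a b p = map_pmf (\<lambda>h. if h then b else a) (bernoulli_pmf p)"

text \<open>Joint law of independent \<open>X\<^sub>1, \<dots>, X\<^sub>n\<close>, realised as the coordinates of a random
  function; coordinates outside \<open>{1..n}\<close> are constantly \<open>0\<close> and never used.\<close>

definition joint_law :: "nat \<Rightarrow> (nat \<Rightarrow> real) \<Rightarrow> (nat \<Rightarrow> real) \<Rightarrow> (nat \<Rightarrow> real) \<Rightarrow> (nat \<Rightarrow> real) pmf" where
  "joint_law n a b p = Pi_pmf {1..n} 0 (\<lambda>i. two_point_pmf (a i) (b i) (p i))"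

text \<open>\<open>value_from L n \<sigma> j\<close> is \<open>V\<^sub>\<sigma>(j)\<close>, where \<open>X\<^sub>i\<close> is the \<open>i\<close>-th coordinate under the
  joint law \<open>L\<close>.\<close>

function value_from :: "(nat \<Rightarrow> real) pmf \<Rightarrow> nat \<Rightarrow> (nat \<Rightarrow> nat) \<Rightarrow> nat \<Rightarrow> real" where
  "value_from L n \<sigma> j =
     (if j > n then 0
      else measure_pmf.expectation L (\<lambda>X. max (X (\<sigma> j)) (value_from L n \<sigma> (j + 1))))"
  by auto
termination
  by (relation "Wellfounded.measure (\<lambda>(L, n, \<sigma>, j). Suc n - j)") auto

declare value_from.simps [simp del]

definition stopping_value :: "(nat \<Rightarrow> real) pmf \<Rightarrow> nat \<Rightarrow> (nat \<Rightarrow> nat) \<Rightarrow> real" where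
  "stopping_value L n \<sigma> = value_from L n \<sigma> 1"


section \<open>Real RAM\<close>

text \<open>Structured programs for a unit-cost real RAM. The machine has integer registers and real
  registers, which are addressed by constants in the program text only (so a program uses
  finitely many), and an integer memory and a real memory, which are addressed indirectly.
  Real cells hold exact real numbers and support the four field operations and comparison.
  Integer cells hold natural numbers and support addition, truncated subtraction and comparison.
  There is no integer multiplication, no rounding and no conversion between the two sorts, and
  the only constants are natural numbers.\<close>

datatype iexp =
    INum nat
  | IReg nat
  | IMem iexp
  | IAdd iexp iexp
  | ISub iexp iexp

datatype rexp =
    RNum nat
  | RReg nat
  | RMem iexp
  | RAdd rexp rexp
  | RSub rexp rexp
  | RMul rexp rexp
  | RDiv rexp rexp

datatype bexp =
    ILess iexp iexp
  | RLess rexp rexp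
  | BNot bexp
  | BAnd bexp bexp

datatype com =
    Skip
  | SetIReg nat iexp
  | SetIMem iexp iexp
  | SetRReg nat rexp
  | SetRMem iexp rexp
  | Seq com com
  | Cond bexp com com
  | While bexp com

record state =
  ireg :: "nat \<Rightarrow> nat"
  imem :: "nat \<Rightarrow> nat"
  rreg :: "nat \<Rightarrow> real"
  rmem :: "nat \<Rightarrow> real"

fun ival :: "iexp \<Rightarrow> state \<Rightarrow> nat" where
  "ival (INum k) s = k"
| "ival (IReg r) s = ireg s r"
| "ival (IMem e) s = imem s (ival e s)"
| "ival (IAdd e f) s = ival e s + ival f s"
| "ival (ISub e f) s = ival e s - ival f s"

text \<open>Division by zero yields \<open>0\<close> as usual in HOL; as programs can test for \<open>0\<close>, this adds no
  computational power.\<close>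

fun rval :: "rexp \<Rightarrow> state \<Rightarrow> real" where
  "rval (RNum k) s = real k"
| "rval (RReg r) s = rreg s r"
| "rval (RMem e) s = rmem s (ival e s)"
| "rval (RAdd e f) s = rval e s + rval f s"
| "rval (RSub e f) s = rval e s - rval f s"
| "rval (RMul e f) s = rval e s * rval f s"
| "rval (RDiv e f) s = rval e s / rval f s"

fun bval :: "bexp \<Rightarrow> state \<Rightarrow> bool" where
  "bval (ILess e f) s \<longleftrightarrow> ival e s < ival f s"
| "bval (RLess e f) s \<longleftrightarrow> rval e s < rval f s"
| "bval (BNot c) s \<longleftrightarrow> \<not> bval c s"
| "bval (BAnd c d) s \<longleftrightarrow> bval c s \<and> bval d s"

text \<open>Every node of an evaluated expression costs one step.\<close>

fun icost :: "iexp \<Rightarrow> nat" where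
  "icost (INum k) = 1"
| "icost (IReg r) = 1"
| "icost (IMem e) = 1 + icost e"
| "icost (IAdd e f) = 1 + icost e + icost f"
| "icost (ISub e f) = 1 + icost e + icost f"

fun rcost :: "rexp \<Rightarrow> nat" where
  "rcost (RNum k) = 1"
| "rcost (RReg r) = 1"
| "rcost (RMem e) = 1 + icost e"
| "rcost (RAdd e f) = 1 + rcost e + rcost f"
| "rcost (RSub e f) = 1 + rcost e + rcost f"
| "rcost (RMul e f) = 1 + rcost e + rcost f"
| "rcost (RDiv e f) = 1 + rcost e + rcost f"

fun bcost :: "bexp \<Rightarrow> nat" where
  "bcost (ILess e f) = 1 + icost e + icost f"
| "bcost (RLess e f) = 1 + rcost e + rcost f"
| "bcost (BNot c) = 1 + bcost c"
| "bcost (BAnd c d) = 1 + bcost c + bcost d"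

text \<open>\<open>runs c s t s'\<close>: started in \<open>s\<close>, the program \<open>c\<close> halts in \<open>s'\<close> after exactly \<open>t\<close> steps.\<close>

inductive runs :: "com \<Rightarrow> state \<Rightarrow> nat \<Rightarrow> state \<Rightarrow> bool" where
  Skip: "runs Skip s 1 s"
| SetIReg: "runs (SetIReg r e) s (1 + icost e) (s\<lparr>ireg := (ireg s)(r := ival e s)\<rparr>)"
| SetIMem: "runs (SetIMem k e) s (1 + icost k + icost e)
              (s\<lparr>imem := (imem s)(ival k s := ival e s)\<rparr>)"
| SetRReg: "runs (SetRReg r e) s (1 + rcost e) (s\<lparr>rreg := (rreg s)(r := rval e s)\<rparr>)"
| SetRMem: "runs (SetRMem k e) s (1 + icost k + rcost e)
              (s\<lparr>rmem := (rmem s)(ival k s := rval e s)\<rparr>)"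
| Seq: "runs c s t s' \<Longrightarrow> runs d s' t' s'' \<Longrightarrow> runs (Seq c d) s (t + t') s''"
| CondTrue: "bval q s \<Longrightarrow> runs c s t s' \<Longrightarrow> runs (Cond q c d) s (1 + bcost q + t) s'"
| CondFalse: "\<not> bval q s \<Longrightarrow> runs d s t s' \<Longrightarrow> runs (Cond q c d) s (1 + bcost q + t) s'"
| WhileFalse: "\<not> bval q s \<Longrightarrow> runs (While q c) s (1 + bcost q) s"
| WhileTrue: "bval q s \<Longrightarrow> runs c s t s' \<Longrightarrow> runs (While q c) s' t' s'' \<Longrightarrow>
              runs (While q c) s (1 + bcost q + t + t') s''"

lemma runs_deterministic:
  "runs c s t s' \<Longrightarrow> runs c s u s'' \<Longrightarrow> t = u \<and> s' = s''"
proof (induction arbitrary: u s'' rule: runs.induct)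
  case (Seq c s t s' d t' s2)
  from Seq.prems show ?case
    by (cases rule: runs.cases) (use Seq.IH in \<open>blast+\<close>)
next
  case (CondTrue q c s t s' d)
  from CondTrue.prems show ?case
    by (cases rule: runs.cases) (use CondTrue.IH CondTrue.hyps in \<open>blast+\<close>)
next
  case (CondFalse q d s t s' c)
  from CondFalse.prems show ?case
    by (cases rule: runs.cases) (use CondFalse.IH CondFalse.hyps in \<open>blast+\<close>)
next
  case (WhileFalse q s c)
  from WhileFalse.prems show ?case
    by (cases rule: runs.cases) (use WhileFalse.hyps in \<open>blast+\<close>)
next
  case (WhileTrue q s c t s' t' s2)
  from WhileTrue.prems show ?case
    by (cases rule: runs.cases) (use WhileTrue.IH WhileTrue.hyps in \<open>blast+\<close>)
qed (erule runs.cases; simp)+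

text \<open>Input convention: \<open>n\<close> in integer register \<open>0\<close>; \<open>a\<^sub>1, \<dots>, a\<^sub>n\<close>, then \<open>b\<^sub>1, \<dots>, b\<^sub>n\<close>, then
  \<open>p\<^sub>1, \<dots>, p\<^sub>n\<close> in the real memory cells \<open>1, \<dots>, 3 n\<close>; everything else is \<open>0\<close>.\<close>

definition input_state :: "nat \<Rightarrow> (nat \<Rightarrow> real) \<Rightarrow> (nat \<Rightarrow> real) \<Rightarrow> (nat \<Rightarrow> real) \<Rightarrow> state" where
  "input_state n a b p =
     \<lparr>ireg = (\<lambda>_. 0)(0 := n),
      imem = (\<lambda>_. 0),
      rreg = (\<lambda>_. 0),
      rmem = (\<lambda>k. if k \<in> {1..n} then a k
                  else if k \<in> {n + 1..2 * n} then b (k - n)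
                  else if k \<in> {2 * n + 1..3 * n} then p (k - 2 * n)
                  else 0)\<rparr>"

text \<open>Output convention: \<open>\<sigma>(1), \<dots>, \<sigma>(n)\<close> in the integer memory cells \<open>1, \<dots>, n\<close>.\<close>

definition outputs_ordering :: "state \<Rightarrow> nat \<Rightarrow> (nat \<Rightarrow> nat) \<Rightarrow> bool" where
  "outputs_ordering s n \<sigma> \<longleftrightarrow> \<sigma> permutes {1..n} \<and> (\<forall>j\<in>{1..n}. imem s j = \<sigma> j)"

end

theory Submission imports Defs "HOL-Real_Asymp.Real_Asymp" begin

text \<open>
  Let \<open>f\<^sub>i v = E[max(X\<^sub>i, v)]\<close>, so that the value of an ordering is
  \<open>f\<^bsub>\<sigma>(1)\<^esub> (\<dots> (f\<^bsub>\<sigma>(n)\<^esub> 0))\<close>, and let \<open>h\<^sub>i v = (1 - p\<^sub>i) v + p\<^sub>i max(b\<^sub>i, v)\<close>. Always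
  \<open>h\<^sub>i \<le> f\<^sub>i\<close>, with equality at \<open>v\<close> if \<open>a\<^sub>i \<le> v\<close>, while for \<open>0 \<le> v \<le> a\<^sub>i\<close> one has
  \<open>f\<^sub>i v = f\<^sub>i 0\<close>, that is, everything observed after \<open>X\<^sub>i\<close> is worthless. Hence the value of any
  ordering is at most that of \<open>h\<close>s applied to \<open>f\<^sub>j 0\<close> for some single \<open>j\<close>. By an exchange
  argument the \<open>h\<^sub>i\<close> are best observed in order of decreasing \<open>b\<^sub>i\<close>. So it suffices to sort by
  decreasing \<open>b\<close> and to try all \<open>n\<close> ways of moving one variable to the end.
\<close>

section \<open>Orderings of two-point variables\<close>

definition gain :: "(nat \<Rightarrow> real) \<Rightarrow> (nat \<Rightarrow> real) \<Rightarrow> (nat \<Rightarrow> real) \<Rightarrow> nat \<Rightarrow> real \<Rightarrow> real" where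
  "gain a b p i v = (1 - p i) * max (a i) v + p i * max (b i) v"

definition upper_gain :: "(nat \<Rightarrow> real) \<Rightarrow> (nat \<Rightarrow> real) \<Rightarrow> nat \<Rightarrow> real \<Rightarrow> real" where
  "upper_gain b p i v = (1 - p i) * v + p i * max (b i) v"

section \<open>The stopping value as a fold of one-step maps\<close>

lemma expectation_two_point_pmf:
  assumes "0 \<le> q" "q \<le> 1"
  shows "measure_pmf.expectation (two_point_pmf x y q) g = (1 - q) * g x + q * g y"
  using assms unfolding two_point_pmf_def by (simp add: integral_bernoulli_pmf algebra_simps)

text \<open>The recursion runs backwards, hence the downward induction from \<open>Suc n\<close>. At
  each stage the continuation value is a number, so the expectation under the joint law depends only
  on the marginal of coordinate \<open>\<sigma> j\<close>.\<close>

lemma value_from_eq_foldr: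
  assumes "\<forall>i\<in>{1..n}. 0 \<le> p i \<and> p i \<le> 1" "\<sigma> permutes {1..n}" "1 \<le> j" "j \<le> Suc n"
  shows "value_from (joint_law n a b p) n \<sigma> j = foldr (gain a b p) (map \<sigma> [j..<Suc n]) 0"
  using assms(4,3)
proof (induction rule: inc_induct)
  case base
  show ?case by (simp add: value_from.simps)
next
  case (step j)
  let ?L = "joint_law n a b p" and ?v = "value_from (joint_law n a b p) n \<sigma> (Suc j)"
  have mem: "\<sigma> j \<in> {1..n}"
    using step assms(2) by (simp add: permutes_in_image del: atLeastAtMost_iff) simp
  have "value_from ?L n \<sigma> j = measure_pmf.expectation ?L (\<lambda>X. max (X (\<sigma> j)) ?v)"
    using step by (subst value_from.simps) simp
  also have "\<dots> = measure_pmf.expectation (map_pmf (\<lambda>X. X (\<sigma> j)) ?L) (\<lambda>x. max x ?v)"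
    by simp
  also have "map_pmf (\<lambda>X. X (\<sigma> j)) ?L = two_point_pmf (a (\<sigma> j)) (b (\<sigma> j)) (p (\<sigma> j))"
    unfolding joint_law_def using mem by (subst Pi_pmf_component) auto
  also have "measure_pmf.expectation \<dots> (\<lambda>x. max x ?v) = gain a b p (\<sigma> j) ?v"
    using assms(1) mem by (subst expectation_two_point_pmf) (auto simp: gain_def)
  finally show ?case
    using step by (simp add: upt_conv_Cons del: upt_Suc)
qed

section \<open>Order properties of the one-step maps\<close>

lemma upper_gain_mono:
  assumes "0 \<le> p i" "p i \<le> 1" "v \<le> w"
  shows "upper_gain b p i v \<le> upper_gain b p i w"
  unfolding upper_gain_def using assms by (intro add_mono mult_left_mono) auto

lemma upper_gain_ge:
  assumes "0 \<le> p i"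
  shows "v \<le> upper_gain b p i v"
  using mult_left_mono[OF max.cobounded2[of v "b i"] assms]
  by (simp add: upper_gain_def algebra_simps)

lemma upper_gain_le_gain:
  assumes "p i \<le> 1"
  shows "upper_gain b p i v \<le> gain a b p i v"
  unfolding upper_gain_def gain_def using assms by (intro add_right_mono mult_left_mono) auto

lemma gain_mono:
  assumes "0 \<le> p i" "p i \<le> 1" "v \<le> w"
  shows "gain a b p i v \<le> gain a b p i w"
  unfolding gain_def using assms by (intro add_mono mult_left_mono) auto

lemma gain_nonneg:
  assumes "0 \<le> p i" "p i \<le> 1" "0 \<le> v"
  shows "0 \<le> gain a b p i v"
  unfolding gain_def using assms by (intro add_nonneg_nonneg mult_nonneg_nonneg) auto

lemma foldr_gain_nonneg:
  assumes "\<forall>i\<in>set xs. 0 \<le> p i \<and> p i \<le> 1"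
  shows "0 \<le> foldr (gain a b p) xs 0"
  using assms by (induction xs) (auto intro: gain_nonneg)

lemma foldr_upper_gain_mono:
  assumes "\<forall>i\<in>set xs. 0 \<le> p i \<and> p i \<le> 1" "v \<le> w"
  shows "foldr (upper_gain b p) xs v \<le> foldr (upper_gain b p) xs w"
  using assms by (induction xs) (auto intro: upper_gain_mono)

lemma foldr_upper_gain_ge:
  assumes "\<forall>i\<in>set xs. 0 \<le> p i"
  shows "v \<le> foldr (upper_gain b p) xs v"
  using assms by (induction xs) (auto intro: order.trans upper_gain_ge)

lemma foldr_upper_gain_le_gain:
  assumes "\<forall>i\<in>set xs. 0 \<le> p i \<and> p i \<le> 1"
  shows "foldr (upper_gain b p) xs v \<le> foldr (gain a b p) xs v"
  using assms
proof (induction xs)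
  case (Cons x xs)
  then show ?case
    using upper_gain_mono[of p x "foldr (upper_gain b p) xs v" "foldr (gain a b p) xs v" b]
      upper_gain_le_gain[of p x b "foldr (gain a b p) xs v" a] by simp
qed simp

section \<open>The exchange argument\<close>

text \<open>The outer map belongs to the variable observed first. Above its threshold
  \<open>b k\<close> an upper gain is the identity, below it is affine. So the maps differ in order
  only through the constant term of two affine maps, or one of them does nothing.\<close>

lemma upper_gain_exchange:
  assumes "0 \<le> p i" "p i \<le> 1" "0 \<le> p j" "p j \<le> 1" "b j \<le> b i"
  shows "upper_gain b p j (upper_gain b p i v) \<le> upper_gain b p i (upper_gain b p j v)"
proof (cases "v \<le> b j")
  case False
  then have "upper_gain b p j w = w" if "v \<le> w" for w
    using that by (simp add: upper_gain_def algebra_simps)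
  moreover have "v \<le> upper_gain b p i v"
    using assms(1) by (rule upper_gain_ge)
  ultimately show ?thesis by simp
next
  case True
  let ?g = "\<lambda>k v. (1 - p k) * v + p k * b k"
  have lower: "upper_gain b p k v = ?g k v" if "v \<le> b k" for k v
    using that by (simp add: upper_gain_def)
  \<comment> \<open>A convex combination of \<open>v\<close> and \<open>b j\<close> does not leave
    the range below \<open>b j \<le> b i\<close>, so the affine formula applies again in the outer
    step.\<close>
  have "?g j v \<le> b j"
    using True assms mult_left_mono[of v "b j" "1 - p j"] by (simp add: algebra_simps)
  then have rhs: "upper_gain b p i (upper_gain b p j v) = ?g i (?g j v)"
    using True assms by (simp add: lower)
  have lhs: "upper_gain b p i v = ?g i v"
    using True assms by (simp add: lower)
  show ?thesis
  proof (cases "?g i v \<le> b j")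
    case True
    have "?g i (?g j v) - ?g j (?g i v) = p i * p j * (b i - b j)"
      by (simp add: algebra_simps)
    also have "\<dots> \<ge> 0" using assms by simp
    finally show ?thesis using True lhs rhs by (simp add: lower)
  next
    \<comment> \<open>On the left \<open>j\<close> now adds nothing, while on the right it can only
      raise the argument of the map for \<open>i\<close>.\<close>
    case False
    then have "upper_gain b p j (?g i v) = ?g i v"
      by (simp add: upper_gain_def algebra_simps)
    then show ?thesis
      using lhs upper_gain_mono[of p i v _ b, OF assms(1,2) upper_gain_ge[of p j v b, OF assms(3)]]
      by simp
  qed
qed

text \<open>Adjacent exchanges carry \<open>x\<close> past one entry after another without
  loss.\<close>

lemma foldr_upper_gain_move_to_front:
  assumes "\<forall>i\<in>set xs. 0 \<le> p i \<and> p i \<le> 1 \<and> b i \<le> b x" "0 \<le> p x" "p x \<le> 1"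
  shows "foldr (upper_gain b p) (xs @ [x]) v \<le> upper_gain b p x (foldr (upper_gain b p) xs v)"
  using assms(1)
proof (induction xs)
  case (Cons y xs)
  have "foldr (upper_gain b p) ((y # xs) @ [x]) v
      \<le> upper_gain b p y (upper_gain b p x (foldr (upper_gain b p) xs v))"
    using Cons by (auto intro: upper_gain_mono)
  also have "\<dots> \<le> upper_gain b p x (upper_gain b p y (foldr (upper_gain b p) xs v))"
    using Cons.prems assms(2,3) by (intro upper_gain_exchange) auto
  finally show ?case by simp
qed simp

text \<open>Selection sort as an induction: the head of \<open>ys\<close> has the largest
  \<open>b\<close>, so it may be pulled to the front of \<open>xs\<close>, and the induction
  hypothesis treats what is left.\<close>

lemma foldr_upper_gain_le_sorted:
  assumes "mset xs = mset ys" "sorted_wrt (\<lambda>i j. b j \<le> b i) ys"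
    and "\<forall>i\<in>set ys. 0 \<le> p i \<and> p i \<le> 1"
  shows "foldr (upper_gain b p) xs v \<le> foldr (upper_gain b p) ys v"
  using assms
proof (induction ys arbitrary: xs)
  case (Cons y ys)
  have "y \<in> set xs"
    using Cons.prems(1) by (metis list.set_intros(1) mset_eq_setD)
  then obtain us ws where xs: "xs = us @ y # ws"
    by (auto simp: in_set_conv_decomp)
  have rest: "mset (us @ ws) = mset ys"
    using Cons.prems(1) xs by simp
  then have "set (us @ ws) = set ys" by (rule mset_eq_setD)
  with Cons.prems have "foldr (upper_gain b p) (us @ [y]) (foldr (upper_gain b p) ws v)
      \<le> upper_gain b p y (foldr (upper_gain b p) us (foldr (upper_gain b p) ws v))"
    by (intro foldr_upper_gain_move_to_front) auto
  then have "foldr (upper_gain b p) xs v \<le> upper_gain b p y (foldr (upper_gain b p) (us @ ws) v)"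
    using xs by simp
  also have "\<dots> \<le> upper_gain b p y (foldr (upper_gain b p) ys v)"
    using Cons.prems by (intro upper_gain_mono Cons.IH[OF rest]) auto
  finally show ?case by simp
qed simp

section \<open>Reduction to n candidate orderings\<close>

text \<open>The cut \<open>x\<close> is the first variable whose lower outcome is at least its
  continuation value. There the gain is constant on the interval from 0 to \<open>a x\<close>, so
  the continuation may be replaced by 0. Before the cut, lower outcomes are below the continuation
  value and gain equals upper gain. If no such variable exists, the cut is the last one, whose
  continuation value is 0 anyway.\<close>

lemma foldr_gain_le_upper_gain:
  assumes "\<forall>i\<in>set xs. a i \<le> b i \<and> 0 \<le> p i \<and> p i \<le> 1" "xs \<noteq> []"
  shows "\<exists>us x ws. xs = us @ x # ws \<and>
           foldr (gain a b p) xs 0 \<le> foldr (upper_gain b p) us (gain a b p x 0)"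
  using assms
proof (induction xs)
  case (Cons y ys)
  let ?v = "foldr (gain a b p) ys 0"
  have v: "0 \<le> ?v"
    using Cons.prems by (intro foldr_gain_nonneg) auto
  show ?case
  proof (cases "?v \<le> a y \<or> ys = []")
    case True
    then have "gain a b p y ?v = gain a b p y 0"
      using Cons.prems v by (auto simp: gain_def max.absorb1)
    then have "y # ys = [] @ y # ys \<and>
        foldr (gain a b p) (y # ys) 0 \<le> foldr (upper_gain b p) [] (gain a b p y 0)"
      by simp
    then show ?thesis by blast
  next
    case False
    with Cons have "\<exists>us x ws. ys = us @ x # ws \<and>
        ?v \<le> foldr (upper_gain b p) us (gain a b p x 0)"
      by simp
    then obtain us x ws where split: "ys = us @ x # ws"
      and le: "?v \<le> foldr (upper_gain b p) us (gain a b p x 0)"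
      by blast
    have "gain a b p y ?v = upper_gain b p y ?v"
      using False by (simp add: gain_def upper_gain_def)
    also have "\<dots> \<le> upper_gain b p y (foldr (upper_gain b p) us (gain a b p x 0))"
      using Cons.prems le by (intro upper_gain_mono) auto
    finally have "y # ys = (y # us) @ x # ws \<and>
        foldr (gain a b p) (y # ys) 0 \<le> foldr (upper_gain b p) (y # us) (gain a b p x 0)"
      using split by simp
    then show ?thesis by blast
  qed
qed simp

text \<open>The value of observing the sorted variables with position \<open>i\<close> moved to the end, if the
  lower outcomes of all other variables are ignored.\<close>

definition candidate_value ::
    "nat \<Rightarrow> (nat \<Rightarrow> real) \<Rightarrow> (nat \<Rightarrow> real) \<Rightarrow> (nat \<Rightarrow> real) \<Rightarrow> (nat \<Rightarrow> nat) \<Rightarrow> nat \<Rightarrow> real" where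
  "candidate_value n a b p \<sigma> i =
     foldr (upper_gain b p) (map \<sigma> (filter (\<lambda>k. k \<noteq> i) [1..<Suc n])) (gain a b p (\<sigma> i) 0)"

lemma mset_map_permutes_upt:
  assumes "\<sigma> permutes {1..n}"
  shows "mset (map \<sigma> [1..<Suc n]) = mset_set {1..n}"
proof -
  have "mset (map \<sigma> [1..<Suc n]) = image_mset \<sigma> (mset_set {1..<Suc n})"
    by (simp del: upt_Suc)
  also have "\<dots> = mset_set (\<sigma> ` {1..<Suc n})"
    using assms by (intro image_mset_mset_set) (auto intro: inj_on_subset[OF permutes_inj])
  also have "\<sigma> ` {1..<Suc n} = {1..n}"
    using permutes_image[OF assms] by (simp add: atLeastLessThanSuc_atLeastAtMost)
  finally show ?thesis .
qed

lemma stopping_value_le_candidate_value: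
  assumes valid: "\<forall>i\<in>{1..n}. a i \<le> b i \<and> 0 \<le> p i \<and> p i \<le> 1"
    and \<sigma>: "\<sigma> permutes {1..n}" and \<tau>: "\<tau> permutes {1..n}" and "0 < n"
    and sorted: "\<And>x y. 1 \<le> x \<Longrightarrow> x < y \<Longrightarrow> y \<le> n \<Longrightarrow> b (\<sigma> y) \<le> b (\<sigma> x)"
  shows "\<exists>i\<in>{1..n}. stopping_value (joint_law n a b p) n \<tau> \<le> candidate_value n a b p \<sigma> i"
proof -
  let ?xs = "map \<tau> [1..<Suc n]"
  have set_xs: "set ?xs = {1..n}"
    using permutes_image[OF \<tau>] by (simp add: atLeastLessThanSuc_atLeastAtMost del: upt_Suc)
  have "\<exists>us x ws. ?xs = us @ x # ws \<and>
      foldr (gain a b p) ?xs 0 \<le> foldr (upper_gain b p) us (gain a b p x 0)"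
    using valid set_xs \<open>0 < n\<close> by (intro foldr_gain_le_upper_gain) auto
  then obtain us x ws where split: "?xs = us @ x # ws"
    and le: "foldr (gain a b p) ?xs 0 \<le> foldr (upper_gain b p) us (gain a b p x 0)"
    by blast
  have in_range: "x \<in> {1..n}" "set us \<subseteq> {1..n}" "set ws \<subseteq> {1..n}"
    using set_xs unfolding split by auto
  then obtain i where i: "i \<in> {1..n}" "x = \<sigma> i"
    using permutes_image[OF \<sigma>] by (metis imageE)
  let ?ys = "map \<sigma> (filter (\<lambda>k. k \<noteq> i) [1..<Suc n])"
  have "mset (map \<sigma> [1..<Suc n]) = mset (\<sigma> i # ?ys)"
  proof -
    have "[1..<Suc n] = [1..<i] @ i # [Suc i..<Suc n]"
      using i upt_add_eq_append[of 1 i "Suc n - i"] by (simp add: upt_conv_Cons del: upt_Suc)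
    moreover have "filter (\<lambda>k. k \<noteq> i) [1..<i] = [1..<i]"
      "filter (\<lambda>k. k \<noteq> i) [Suc i..<Suc n] = [Suc i..<Suc n]"
      by (auto simp: filter_id_conv)
    ultimately show ?thesis by (simp del: upt_Suc)
  qed
  then have "mset (us @ x # ws) = mset (\<sigma> i # ?ys)"
    using mset_map_permutes_upt[OF \<sigma>] mset_map_permutes_upt[OF \<tau>] split by metis
  then have "mset (us @ ws) = mset ?ys"
    using i by (simp del: upt_Suc)
  moreover have "sorted_wrt (\<lambda>i j. b j \<le> b i) ?ys"
    unfolding sorted_wrt_map
    by (intro sorted_wrt_filter sorted_wrt_mono_rel[OF _ sorted_wrt_upt])
      (auto intro: sorted)
  moreover have "set ?ys \<subseteq> {1..n}"
    using permutes_image[OF \<sigma>] by auto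
  ultimately have "foldr (upper_gain b p) (us @ ws) (gain a b p x 0)
      \<le> foldr (upper_gain b p) ?ys (gain a b p x 0)"
    using valid by (intro foldr_upper_gain_le_sorted) auto
  \<comment> \<open>The variables \<open>ws\<close> behind the cut are reinserted in front of
    \<open>x\<close>. An upper gain never lowers its argument, so this loses nothing and leaves
    \<open>x\<close> as the last of all variables.\<close>
  moreover have "foldr (upper_gain b p) us (gain a b p x 0)
      \<le> foldr (upper_gain b p) us (foldr (upper_gain b p) ws (gain a b p x 0))"
    using valid in_range by (intro foldr_upper_gain_mono foldr_upper_gain_ge) auto
  moreover have "stopping_value (joint_law n a b p) n \<tau> = foldr (gain a b p) ?xs 0"
    unfolding stopping_value_def using valid \<tau> by (intro value_from_eq_foldr) auto
  ultimately show ?thesis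
    using i le by (intro bexI[of _ i]) (auto simp: candidate_value_def)
qed

text \<open>The ordering \<open>\<rho>\<close> observes exactly the sequence in the fold and then
  \<open>\<sigma> i\<close>, and gains dominate upper gains. With the previous lemma, candidates and
  true values bound each other, so a best candidate yields an optimal ordering.\<close>

lemma candidate_value_le_stopping_value:
  assumes valid: "\<forall>i\<in>{1..n}. 0 \<le> p i \<and> p i \<le> 1"
    and \<sigma>: "\<sigma> permutes {1..n}" and \<rho>: "\<rho> permutes {1..n}" and i: "i \<in> {1..n}"
    and shift: "\<And>x. x \<in> {1..n} \<Longrightarrow>
      \<rho> x = (if x < i then \<sigma> x else if x < n then \<sigma> (Suc x) else \<sigma> i)"
  shows "candidate_value n a b p \<sigma> i \<le> stopping_value (joint_law n a b p) n \<rho>"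
proof -
  let ?ys = "map \<sigma> (filter (\<lambda>k. k \<noteq> i) [1..<Suc n])"
  have upt: "[1..<Suc n] = [1..<i] @ i # [Suc i..<Suc n]"
    using i upt_add_eq_append[of 1 i "Suc n - i"] by (simp add: upt_conv_Cons del: upt_Suc)
  have filter: "filter (\<lambda>k. k \<noteq> i) [1..<i] = [1..<i]"
    "filter (\<lambda>k. k \<noteq> i) [Suc i..<Suc n] = [Suc i..<Suc n]"
    by (auto simp: filter_id_conv)
  have ys: "?ys = map \<sigma> [1..<i] @ map \<sigma> [Suc i..<Suc n]"
    unfolding upt using filter by (simp del: upt_Suc)
  \<comment> \<open>Unlike the split at \<open>i\<close> for \<open>\<sigma>\<close>, this one is
    made for \<open>\<rho>\<close>: its middle block holds the entries of \<open>\<sigma>\<close>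
    one position further on.\<close>
  have "[1..<Suc n] = [1..<i] @ [i..<n] @ [n]"
    using i upt_add_eq_append[of 1 i "n - i"] by simp
  moreover have "map \<rho> [1..<i] = map \<sigma> [1..<i]"
    using i shift by auto
  moreover have "map \<rho> [i..<n] = map \<sigma> [Suc i..<Suc n]"
    using i shift by (simp flip: map_Suc_upt del: upt_Suc)
  moreover have "\<rho> n = \<sigma> i"
    using i shift by auto
  ultimately have "map \<rho> [1..<Suc n] = ?ys @ [\<sigma> i]"
    unfolding ys by simp
  moreover have "stopping_value (joint_law n a b p) n \<rho> = foldr (gain a b p) (map \<rho> [1..<Suc n]) 0"
    unfolding stopping_value_def using valid \<rho> by (intro value_from_eq_foldr) auto
  moreover have "set ?ys \<subseteq> {1..n}"
    using permutes_image[OF \<sigma>] by auto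
  then have "foldr (upper_gain b p) ?ys v \<le> foldr (gain a b p) ?ys v" for v
    using valid by (intro foldr_upper_gain_le_gain) auto
  ultimately show ?thesis
    by (simp add: candidate_value_def)
qed

text \<open>This justifies the start of the search for the maximum, with 0 as best value and
  \<open>n\<close> as best position.\<close>

lemma candidate_value_nonneg:
  assumes "\<forall>i\<in>{1..n}. 0 \<le> p i \<and> p i \<le> 1" "\<sigma> permutes {1..n}" "i \<in> {1..n}"
  shows "0 \<le> candidate_value n a b p \<sigma> i"
proof -
  have "\<sigma> i \<in> {1..n}"
    using assms(2,3) by (simp add: permutes_in_image del: atLeastAtMost_iff)
  then have "0 \<le> gain a b p (\<sigma> i) 0"
    using assms(1) by (intro gain_nonneg) auto
  also have "\<dots> \<le> candidate_value n a b p \<sigma> i"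
    unfolding candidate_value_def using assms permutes_image[OF assms(2)]
    by (intro foldr_upper_gain_ge) auto
  finally show ?thesis .
qed

section \<open>Total correctness with running time\<close>

text \<open>Being a predicate on start states, it can serve as the postcondition of a preceding
  program, which is how sequential composition is treated.\<close>

definition halts_within :: "com \<Rightarrow> nat \<Rightarrow> (state \<Rightarrow> bool) \<Rightarrow> state \<Rightarrow> bool" where
  "halts_within c T Q s \<longleftrightarrow> (\<exists>t s'. runs c s t s' \<and> t \<le> T \<and> Q s')"

lemma halts_within_Seq:
  assumes "halts_within c T (halts_within d U Q) s"
  shows "halts_within (Seq c d) (T + U) Q s"
  using assms unfolding halts_within_def by (meson add_mono runs.Seq)

lemma halts_within_mono:
  assumes "halts_within c T P s" "T \<le> U" "\<And>s. P s \<Longrightarrow> Q s"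
  shows "halts_within c U Q s"
  using assms unfolding halts_within_def by (meson order.trans)

text \<open>The invariant is indexed by a counter from \<open>l\<close> to \<open>h\<close>. The
  final failing test is charged like a full round, whence the factor
  \<open>Suc (h - l)\<close>.\<close>

lemma halts_within_While:
  assumes init: "I l s" "l \<le> h"
    and step: "\<And>i s. l \<le> i \<Longrightarrow> i < h \<Longrightarrow> I i s \<Longrightarrow> bval q s \<and> halts_within c T (I (Suc i)) s"
    and exit: "\<And>s. I h s \<Longrightarrow> \<not> bval q s"
  shows "halts_within (While q c) (Suc (h - l) * (1 + bcost q + T)) (I h) s"
proof -
  have "halts_within (While q c) (Suc (h - i) * (1 + bcost q + T)) (I h) s"
    if "i \<le> h" "l \<le> i" "I i s" for i s
    using that
  proof (induction arbitrary: s rule: inc_induct)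
    case base
    then show ?case
      using exit[of s] runs.WhileFalse[of q s c] by (force simp: halts_within_def)
  next
    case (step i)
    then obtain t s' where 1: "bval q s" "runs c s t s'" "t \<le> T" "I (Suc i) s'"
      using assms(3)[of i s] by (auto simp: halts_within_def)
    then obtain u s'' where 2: "runs (While q c) s' u s''"
      "u \<le> Suc (h - Suc i) * (1 + bcost q + T)" "I h s''"
      using step.IH[of s'] step.prems by (auto simp: halts_within_def)
    have "Suc (h - i) * (1 + bcost q + T)
        = 1 + bcost q + T + Suc (h - Suc i) * (1 + bcost q + T)"
      using step.hyps by (simp add: Suc_diff_Suc)
    then have "1 + bcost q + t + u \<le> Suc (h - i) * (1 + bcost q + T)"
      using 1(3) 2(2) by linarith
    then show ?case
      using runs.WhileTrue[OF 1(1,2) 2(1)] 2(3) unfolding halts_within_def by blast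
  qed
  then show ?thesis using init by blast
qed

text \<open>Code without loops always halts, so its final state and a step bound are given by plain
  recursion and \<open>simp\<close> can execute it symbolically. Only loops need invariants.\<close>

fun loop_free :: "com \<Rightarrow> bool" where
  "loop_free (Seq c d) \<longleftrightarrow> loop_free c \<and> loop_free d"
| "loop_free (Cond q c d) \<longleftrightarrow> loop_free c \<and> loop_free d"
| "loop_free (While q c) \<longleftrightarrow> False"
| "loop_free _ \<longleftrightarrow> True"

text \<open>The equations for \<open>While\<close> in the next two functions are junk.\<close>

fun exec :: "com \<Rightarrow> state \<Rightarrow> state" where
  "exec Skip s = s"
| "exec (SetIReg r e) s = s\<lparr>ireg := (ireg s)(r := ival e s)\<rparr>"
| "exec (SetIMem k e) s = s\<lparr>imem := (imem s)(ival k s := ival e s)\<rparr>"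
| "exec (SetRReg r e) s = s\<lparr>rreg := (rreg s)(r := rval e s)\<rparr>"
| "exec (SetRMem k e) s = s\<lparr>rmem := (rmem s)(ival k s := rval e s)\<rparr>"
| "exec (Seq c d) s = exec d (exec c s)"
| "exec (Cond q c d) s = (if bval q s then exec c s else exec d s)"
| "exec (While q c) s = s"

fun max_steps :: "com \<Rightarrow> nat" where
  "max_steps Skip = 1"
| "max_steps (SetIReg r e) = 1 + icost e"
| "max_steps (SetIMem k e) = 1 + icost k + icost e"
| "max_steps (SetRReg r e) = 1 + rcost e"
| "max_steps (SetRMem k e) = 1 + icost k + rcost e"
| "max_steps (Seq c d) = max_steps c + max_steps d"
| "max_steps (Cond q c d) = 1 + bcost q + max (max_steps c) (max_steps d)"
| "max_steps (While q c) = 0"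

lemma runs_exec:
  assumes "loop_free c"
  shows "\<exists>t\<le>max_steps c. runs c s t (exec c s)"
  using assms
proof (induction c arbitrary: s)
  case (Seq c d)
  then obtain t u where "t \<le> max_steps c" "runs c s t (exec c s)"
    "u \<le> max_steps d" "runs d (exec c s) u (exec d (exec c s))"
    by (metis loop_free.simps(1))
  then show ?case
    by (intro exI[of _ "t + u"]) (auto intro: runs.Seq)
next
  case (Cond q c d)
  show ?case
  proof (cases "bval q s")
    case True
    from Cond obtain t where "t \<le> max_steps c" "runs c s t (exec c s)" by auto
    with True show ?thesis
      by (intro exI[of _ "1 + bcost q + t"]) (auto intro: runs.CondTrue[simplified])
  next
    case False
    from Cond obtain t where "t \<le> max_steps d" "runs d s t (exec d s)" by auto
    with False show ?thesis
      by (intro exI[of _ "1 + bcost q + t"]) (auto intro: runs.CondFalse[simplified])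
  qed
qed (force intro: runs.intros[simplified])+

lemma halts_within_exec:
  assumes "loop_free c" "Q (exec c s)"
  shows "halts_within c (max_steps c) Q s"
  using runs_exec[OF assms(1)] assms(2) unfolding halts_within_def by blast

section \<open>The program\<close>

text \<open>Integer registers 1 and 2 are loop counters, 3 holds the best last position found so far and 4
  is scratch space; real register 0 holds the current candidate value and 1 the best one.\<close>

definition swap_cells :: "iexp \<Rightarrow> iexp \<Rightarrow> com" where
  "swap_cells e f = Seq (SetIReg 4 (IMem e)) (Seq (SetIMem e (IMem f)) (SetIMem f (IReg 4)))"

text \<open>Here \<open>e\<close> is a position in the ordering: the index stored there is the
  address within the input block. The blocks lie behind offsets 0, n and 2n; as integers cannot be
  multiplied, 2n is written as a sum.\<close>

definition a_at :: "iexp \<Rightarrow> rexp" where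
  "a_at e = RMem (IMem e)"

definition b_at :: "iexp \<Rightarrow> rexp" where
  "b_at e = RMem (IAdd (IReg 0) (IMem e))"

definition p_at :: "iexp \<Rightarrow> rexp" where
  "p_at e = RMem (IAdd (IAdd (IReg 0) (IReg 0)) (IMem e))"

definition incr :: "nat \<Rightarrow> com" where
  "incr r = SetIReg r (IAdd (IReg r) (INum 1))"

definition init_step :: com where
  "init_step = Seq (incr 1) (SetIMem (IReg 1) (IReg 1))"

definition init_prog :: com where
  "init_prog = While (ILess (IReg 1) (IReg 0)) init_step"

definition sort_step :: com where
  "sort_step = Seq (incr 2)
     (Cond (RLess (b_at (IReg 1)) (b_at (IReg 2))) (swap_cells (IReg 1) (IReg 2)) Skip)"

definition sort_row :: com where
  "sort_row = Seq (Seq (incr 1) (SetIReg 2 (IReg 1)))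
     (While (ILess (IReg 2) (IReg 0)) sort_step)"

definition sort_prog :: com where
  "sort_prog = Seq (SetIReg 1 (INum 0)) (While (ILess (IReg 1) (IReg 0)) sort_row)"

text \<open>The machine has no maximum, so the two positive parts in the gain at 0 become
  conditionals.\<close>

definition eval_init :: com where
  "eval_init = Seq (incr 1) (Seq (SetIReg 2 (IReg 0)) (Seq (SetRReg 0 (RNum 0))
     (Seq (Cond (RLess (RNum 0) (b_at (IReg 1)))
             (SetRReg 0 (RMul (p_at (IReg 1)) (b_at (IReg 1)))) Skip)
          (Cond (RLess (RNum 0) (a_at (IReg 1)))
             (SetRReg 0 (RAdd (RReg 0) (RMul (RSub (RNum 1) (p_at (IReg 1))) (a_at (IReg 1)))))
             Skip))))"

text \<open>Positions are visited from \<open>n\<close> down to 1, because the variable observed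
  last acts on the value first. With strict comparison only, inequality of positions is the negation
  of "neither is smaller".\<close>

definition eval_step :: com where
  "eval_step = Seq
     (Cond (BAnd (BNot (BAnd (BNot (ILess (IReg 1) (IReg 2))) (BNot (ILess (IReg 2) (IReg 1)))))
                 (RLess (RReg 0) (b_at (IReg 2))))
        (SetRReg 0 (RAdd (RMul (RSub (RNum 1) (p_at (IReg 2))) (RReg 0))
                         (RMul (p_at (IReg 2)) (b_at (IReg 2)))))
        Skip)
     (SetIReg 2 (ISub (IReg 2) (INum 1)))"

definition eval_update :: com where
  "eval_update = Cond (RLess (RReg 1) (RReg 0))
     (Seq (SetRReg 1 (RReg 0)) (SetIReg 3 (IReg 1))) Skip"

definition eval_row :: com where
  "eval_row = Seq eval_init (Seq (While (ILess (INum 0) (IReg 2)) eval_step) eval_update)"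

definition eval_prog :: com where
  "eval_prog = Seq (Seq (SetIReg 1 (INum 0)) (SetIReg 3 (IReg 0)))
     (While (ILess (IReg 1) (IReg 0)) eval_row)"

text \<open>Adjacent swaps carry the chosen variable to the end and keep the order of the others.
  Register 3 holds its position and doubles as loop counter.\<close>

definition shift_step :: com where
  "shift_step = Seq (swap_cells (IReg 3) (IAdd (IReg 3) (INum 1))) (incr 3)"

definition shift_prog :: com where
  "shift_prog = While (ILess (IReg 3) (IReg 0)) shift_step"

definition ordering_prog :: com where
  "ordering_prog = Seq init_prog (Seq sort_prog (Seq eval_prog shift_prog))"

section \<open>Orderings in memory and partial sortedness\<close>

lemma outputs_ordering_swap:
  assumes "outputs_ordering s n \<sigma>" "i \<in> {1..n}" "j \<in> {1..n}"
    and "imem s' = (imem s)(i := imem s j, j := imem s i)"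
  shows "outputs_ordering s' n (\<sigma> \<circ> Transposition.transpose i j)"
  using assms by (auto simp: outputs_ordering_def transpose_def
      intro: permutes_compose[OF permutes_swap_id])

lemma rmem_input_state:
  assumes "i \<in> {1..n}"
  shows "rmem (input_state n a b p) i = a i"
    "rmem (input_state n a b p) (n + i) = b i"
    "rmem (input_state n a b p) (n + n + i) = p i"
  using assms by (auto simp: input_state_def)

text \<open>The progress of exchange sort once positions \<open>1, \<dots>, k\<close> are final and position \<open>k + 1\<close> has
  been compared with the positions up to \<open>m\<close>.\<close>

definition sorted_upto :: "nat \<Rightarrow> (nat \<Rightarrow> real) \<Rightarrow> (nat \<Rightarrow> nat) \<Rightarrow> nat \<Rightarrow> nat \<Rightarrow> bool" where
  "sorted_upto n b \<sigma> k m \<longleftrightarrow>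
     (\<forall>x y. 1 \<le> x \<and> x < y \<and> y \<le> n \<and> (x \<le> k \<or> x = Suc k \<and> y \<le> m) \<longrightarrow> b (\<sigma> y) \<le> b (\<sigma> x))"

text \<open>Final positions dominate all later entries, so swapping two later ones does them no
  harm. The new entry at \<open>Suc k\<close> exceeds the old one, which dominated the positions up
  to \<open>m\<close>.\<close>

lemma sorted_upto_swap:
  assumes "sorted_upto n b \<sigma> k m" "Suc k \<le> m" "m < n" "b (\<sigma> (Suc k)) < b (\<sigma> (Suc m))"
  shows "sorted_upto n b (\<sigma> \<circ> Transposition.transpose (Suc k) (Suc m)) k (Suc m)"
  unfolding sorted_upto_def
proof (intro allI impI)
  fix x y assume xy: "1 \<le> x \<and> x < y \<and> y \<le> n \<and> (x \<le> k \<or> x = Suc k \<and> y \<le> Suc m)"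
  have le: "b (\<sigma> v) \<le> b (\<sigma> u)" if "1 \<le> u" "u < v" "v \<le> n" "u \<le> k \<or> u = Suc k \<and> v \<le> m" for u v
    using assms(1) that unfolding sorted_upto_def by blast
  show "b ((\<sigma> \<circ> Transposition.transpose (Suc k) (Suc m)) y) \<le> b ((\<sigma> \<circ> Transposition.transpose (Suc k) (Suc m)) x)"
  proof (cases "x \<le> k")
    case True
    then have "Transposition.transpose (Suc k) (Suc m) x = x"
      using assms(2) by (auto simp: Transposition.transpose_def)
    then show ?thesis
      using True xy assms(2,3) by (auto simp: Transposition.transpose_def intro!: le)
  next
    case False
    then have "x = Suc k" "y \<le> Suc m" using xy by auto
    then show ?thesis
      using xy assms(2-4) le[of "Suc k" y] by (auto simp: Transposition.transpose_def)
  qed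
qed

lemma sorted_upto_step:
  assumes "sorted_upto n b \<sigma> k m" "Suc m \<le> n \<Longrightarrow> b (\<sigma> (Suc m)) \<le> b (\<sigma> (Suc k))"
  shows "sorted_upto n b \<sigma> k (Suc m)"
  using assms unfolding sorted_upto_def by (metis le_Suc_eq)

context
  fixes n :: nat and a b p :: "nat \<Rightarrow> real"
begin

text \<open>Only indices are permuted. The program never writes to the real memory, so the whole of
  it can be kept in the invariants.\<close>

definition inputs_kept :: "state \<Rightarrow> bool" where
  "inputs_kept s \<longleftrightarrow> ireg s 0 = n \<and> rmem s = rmem (input_state n a b p)"

lemma rval_at:
  assumes "inputs_kept s" "imem s (ival e s) \<in> {1..n}"
  shows "rval (a_at e) s = a (imem s (ival e s))"
    "rval (b_at e) s = b (imem s (ival e s))"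
    "rval (p_at e) s = p (imem s (ival e s))"
  using assms rmem_input_state[of "imem s (ival e s)" n a b p]
  by (simp_all add: inputs_kept_def a_at_def b_at_def p_at_def del: atLeastAtMost_iff)

lemma outputs_ordering_at:
  assumes "outputs_ordering s n \<sigma>" "i \<in> {1..n}"
  shows "imem s i = \<sigma> i" "imem s i \<in> {1..n}"
  using assms unfolding outputs_ordering_def by (metis permutes_in_image)+

text \<open>In this and the later loop bounds, the summand 4 is one step for the loop and three for
  its guard.\<close>

lemma init_prog_halts:
  "halts_within init_prog (Suc n * (4 + max_steps init_step))
     (\<lambda>s. inputs_kept s \<and> rreg s 1 = 0 \<and> outputs_ordering s n id) (input_state n a b p)"
proof -
  define I where "I k s \<longleftrightarrow> inputs_kept s \<and> rreg s 1 = 0 \<and> ireg s 1 = k \<and> (\<forall>j\<in>{1..k}. imem s j = j)"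
    for k s
  have "halts_within init_prog (Suc (n - 0) * (1 + bcost (ILess (IReg 1) (IReg 0)) + max_steps init_step))
      (I n) (input_state n a b p)"
    unfolding init_prog_def
  proof (rule halts_within_While)
    fix k s assume "k < n" "I k s"
    then have "I (Suc k) (exec init_step s)"
      by (auto simp: I_def inputs_kept_def init_step_def incr_def le_Suc_eq)
    then have "halts_within init_step (max_steps init_step) (I (Suc k)) s"
      by (intro halts_within_exec) (auto simp: init_step_def incr_def)
    then show "bval (ILess (IReg 1) (IReg 0)) s
        \<and> halts_within init_step (max_steps init_step) (I (Suc k)) s"
      using \<open>k < n\<close> \<open>I k s\<close> by (simp add: I_def inputs_kept_def)
  qed (auto simp: I_def inputs_kept_def input_state_def)
  then show ?thesis
    by (rule halts_within_mono) (auto simp: I_def outputs_ordering_def permutes_id algebra_simps)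
qed

section \<open>Sorting by decreasing upper outcome\<close>

text \<open>The clause on real register 1 is carried along for the evaluation phase, which takes the
  0 from the input convention as its first best value.\<close>

definition sort_inv :: "nat \<Rightarrow> nat \<Rightarrow> state \<Rightarrow> bool" where
  "sort_inv k m s \<longleftrightarrow> inputs_kept s \<and> rreg s 1 = 0 \<and>
     (\<exists>\<sigma>. outputs_ordering s n \<sigma> \<and> sorted_upto n b \<sigma> k m)"

lemma exec_sort_step:
  assumes "sort_inv k m s" "ireg s 1 = Suc k" "ireg s 2 = m" "Suc k \<le> m" "m < n"
  shows "sort_inv k (Suc m) (exec sort_step s) \<and>
    ireg (exec sort_step s) 1 = Suc k \<and> ireg (exec sort_step s) 2 = Suc m"
proof -
  obtain \<sigma> where \<sigma>: "outputs_ordering s n \<sigma>" "sorted_upto n b \<sigma> k m"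
    using assms(1) unfolding sort_inv_def by blast
  let ?s = "s\<lparr>ireg := (ireg s)(2 := Suc m)\<rparr>"
  let ?q = "RLess (b_at (IReg 1)) (b_at (IReg 2))"
  have kept: "inputs_kept ?s" and ord: "outputs_ordering ?s n \<sigma>"
    using assms(1) \<sigma>(1) by (auto simp: sort_inv_def inputs_kept_def outputs_ordering_def)
  have range: "Suc k \<in> {1..n}" "Suc m \<in> {1..n}" using assms by auto
  have q: "bval ?q ?s \<longleftrightarrow> b (\<sigma> (Suc k)) < b (\<sigma> (Suc m))"
    using rval_at(2)[OF kept, of "IReg 1"] rval_at(2)[OF kept, of "IReg 2"]
      outputs_ordering_at[OF ord range(1)] outputs_ordering_at[OF ord range(2)] assms(2)
    by simp
  have step: "exec sort_step s = (if bval ?q ?s then exec (swap_cells (IReg 1) (IReg 2)) ?s else ?s)"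
    using assms(3) by (simp add: sort_step_def incr_def del: bval.simps)
  show ?thesis
  proof (cases "bval ?q ?s")
    case True
    let ?s' = "exec (swap_cells (IReg 1) (IReg 2)) ?s"
    have "imem ?s' = (imem ?s)(Suc k := imem ?s (Suc m), Suc m := imem ?s (Suc k))"
      using assms(2) by (simp add: swap_cells_def)
    then have "outputs_ordering ?s' n (\<sigma> \<circ> Transposition.transpose (Suc k) (Suc m))"
      by (rule outputs_ordering_swap[OF ord range])
    moreover have "sorted_upto n b (\<sigma> \<circ> Transposition.transpose (Suc k) (Suc m)) k (Suc m)"
      using True q \<sigma>(2) assms by (intro sorted_upto_swap) auto
    moreover have "inputs_kept ?s'" "rreg ?s' 1 = 0" "ireg ?s' 1 = Suc k" "ireg ?s' 2 = Suc m"
      using assms by (auto simp: sort_inv_def inputs_kept_def swap_cells_def)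
    ultimately show ?thesis
      unfolding step using True by (auto simp: sort_inv_def)
  next
    case False
    then have "sorted_upto n b \<sigma> k (Suc m)"
      using q \<sigma>(2) by (intro sorted_upto_step) auto
    then show ?thesis
      unfolding step using False kept ord assms by (auto simp: sort_inv_def)
  qed
qed

lemma sort_row_halts:
  assumes "sort_inv k 0 s" "ireg s 1 = k" "k < n"
  shows "halts_within sort_row (max_steps (Seq (incr 1) (SetIReg 2 (IReg 1)))
      + Suc n * (4 + max_steps sort_step)) (\<lambda>s. sort_inv (Suc k) 0 s \<and> ireg s 1 = Suc k) s"
proof -
  define I where "I m s \<longleftrightarrow> sort_inv k m s \<and> ireg s 1 = Suc k \<and> ireg s 2 = m" for m s
  let ?q = "ILess (IReg 2) (IReg 0)"
  have loop: "halts_within (While ?q sort_step) (Suc (n - Suc k) * (1 + bcost ?q + max_steps sort_step))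
      (I n) s" if "I (Suc k) s" for s
    using that
  proof (rule halts_within_While)
    fix m s assume "Suc k \<le> m" "m < n" "I m s"
    then have "I (Suc m) (exec sort_step s)"
      using exec_sort_step[of k m s] by (auto simp: I_def)
    then have "halts_within sort_step (max_steps sort_step) (I (Suc m)) s"
      by (intro halts_within_exec) (auto simp: sort_step_def incr_def swap_cells_def)
    then show "bval ?q s \<and> halts_within sort_step (max_steps sort_step) (I (Suc m)) s"
      using \<open>m < n\<close> \<open>I m s\<close> by (simp add: I_def sort_inv_def inputs_kept_def)
  qed (use assms in \<open>auto simp: I_def sort_inv_def inputs_kept_def\<close>)
  \<comment> \<open>No position lies strictly after \<open>Suc k\<close> and not after
    \<open>Suc k\<close>, so nothing has to be compared yet.\<close>
  have "sorted_upto n b \<sigma> k 0 \<Longrightarrow> sorted_upto n b \<sigma> k (Suc k)" for \<sigma>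
    by (auto simp: sorted_upto_def)
  then have "I (Suc k) (exec (Seq (incr 1) (SetIReg 2 (IReg 1))) s)"
    using assms by (auto simp: I_def sort_inv_def inputs_kept_def incr_def outputs_ordering_def)
  then have "halts_within (Seq (incr 1) (SetIReg 2 (IReg 1)))
      (max_steps (Seq (incr 1) (SetIReg 2 (IReg 1))))
      (halts_within (While ?q sort_step) (Suc (n - Suc k) * (1 + bcost ?q + max_steps sort_step)) (I n)) s"
    by (intro halts_within_exec loop) (auto simp: incr_def)
  then have "halts_within sort_row (max_steps (Seq (incr 1) (SetIReg 2 (IReg 1)))
      + Suc (n - Suc k) * (1 + bcost ?q + max_steps sort_step)) (I n) s"
    unfolding sort_row_def by (rule halts_within_Seq)
  then show ?thesis
  proof (rule halts_within_mono)
    show "max_steps (Seq (incr 1) (SetIReg 2 (IReg 1)))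
        + Suc (n - Suc k) * (1 + bcost ?q + max_steps sort_step)
      \<le> max_steps (Seq (incr 1) (SetIReg 2 (IReg 1))) + Suc n * (4 + max_steps sort_step)"
      by (intro add_mono mult_mono) auto
    \<comment> \<open>A completed row makes one more position final.\<close>
    have "sorted_upto n b \<sigma> k n \<Longrightarrow> sorted_upto n b \<sigma> (Suc k) 0" for \<sigma>
      by (auto simp: sorted_upto_def le_Suc_eq)
    then show "sort_inv (Suc k) 0 s \<and> ireg s 1 = Suc k" if "I n s" for s
      using that by (auto simp: I_def sort_inv_def)
  qed
qed

lemma sort_prog_halts:
  assumes "inputs_kept s" "rreg s 1 = 0" "outputs_ordering s n \<sigma>"
  shows "halts_within sort_prog (2 + Suc n * (4 + (max_steps (Seq (incr 1) (SetIReg 2 (IReg 1)))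
      + Suc n * (4 + max_steps sort_step)))) (sort_inv n 0) s"
proof -
  define I where "I k s \<longleftrightarrow> sort_inv k 0 s \<and> ireg s 1 = k" for k s
  let ?q = "ILess (IReg 1) (IReg 0)"
  let ?T = "max_steps (Seq (incr 1) (SetIReg 2 (IReg 1))) + Suc n * (4 + max_steps sort_step)"
  have loop: "halts_within (While ?q sort_row) (Suc (n - 0) * (1 + bcost ?q + ?T)) (I n) s"
    if "I 0 s" for s
    using that
  proof (rule halts_within_While)
    fix k s assume "k < n" "I k s"
    then have "halts_within sort_row ?T (I (Suc k)) s"
      by (intro halts_within_mono[OF sort_row_halts[of k s]]) (auto simp: I_def)
    then show "bval ?q s \<and> halts_within sort_row ?T (I (Suc k)) s"
      using \<open>k < n\<close> \<open>I k s\<close> by (simp add: I_def sort_inv_def inputs_kept_def)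
  qed (auto simp: I_def sort_inv_def inputs_kept_def)
  have "I 0 (exec (SetIReg 1 (INum 0)) s)"
    using assms by (auto simp: I_def sort_inv_def inputs_kept_def outputs_ordering_def sorted_upto_def)
  then have "halts_within (SetIReg 1 (INum 0)) (max_steps (SetIReg 1 (INum 0)))
      (halts_within (While ?q sort_row) (Suc (n - 0) * (1 + bcost ?q + ?T)) (I n)) s"
    by (intro halts_within_exec loop) auto
  then have "halts_within sort_prog (max_steps (SetIReg 1 (INum 0))
      + Suc (n - 0) * (1 + bcost ?q + ?T)) (I n) s"
    unfolding sort_prog_def by (rule halts_within_Seq)
  then show ?thesis
    by (rule halts_within_mono) (simp_all add: I_def algebra_simps)
qed

section \<open>Evaluating the candidates\<close>

text \<open>An inequality ties the best value to the best position, since the initial best value 0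
  need not be attained. At \<open>k = n\<close> the two bounds together make the candidate at
  register 3 maximal. For \<open>n = 0\<close> that register is 0, hence the implication.\<close>

definition eval_inv :: "(nat \<Rightarrow> nat) \<Rightarrow> nat \<Rightarrow> state \<Rightarrow> bool" where
  "eval_inv \<sigma> k s \<longleftrightarrow> inputs_kept s \<and> outputs_ordering s n \<sigma> \<and> ireg s 3 \<le> n \<and>
     (0 < n \<longrightarrow> 1 \<le> ireg s 3 \<and> rreg s 1 \<le> candidate_value n a b p \<sigma> (ireg s 3)) \<and>
     (\<forall>i\<in>{1..k}. candidate_value n a b p \<sigma> i \<le> rreg s 1)"

text \<open>A frame property: loop counters and the current value may change freely.\<close>

lemma eval_inv_cong:
  assumes "eval_inv \<sigma> k s" "imem s' = imem s" "rmem s' = rmem s"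
    and "ireg s' 0 = ireg s 0" "ireg s' 3 = ireg s 3" "rreg s' 1 = rreg s 1"
  shows "eval_inv \<sigma> k s'"
  using assms by (simp add: eval_inv_def inputs_kept_def outputs_ordering_def)

lemma exec_eval_init:
  assumes "eval_inv \<sigma> k s" "ireg s 1 = k" "k < n" "\<forall>i\<in>{1..n}. a i \<le> b i"
  shows "eval_inv \<sigma> k (exec eval_init s) \<and> ireg (exec eval_init s) 1 = Suc k \<and>
    ireg (exec eval_init s) 2 = n \<and> rreg (exec eval_init s) 0 = gain a b p (\<sigma> (Suc k)) 0"
proof -
  have kept: "inputs_kept s" and ord: "outputs_ordering s n \<sigma>"
    using assms(1) by (auto simp: eval_inv_def)
  have range: "Suc k \<in> {1..n}" using assms(3) by simp
  note at = outputs_ordering_at[OF ord range]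
  have ab: "a (\<sigma> (Suc k)) \<le> b (\<sigma> (Suc k))"
    using at assms(4) by simp
  have cells: "ireg s 0 = n" "imem s (Suc k) = \<sigma> (Suc k)"
    "rmem s (\<sigma> (Suc k)) = a (\<sigma> (Suc k))" "rmem s (n + \<sigma> (Suc k)) = b (\<sigma> (Suc k))"
    "rmem s (n + n + \<sigma> (Suc k)) = p (\<sigma> (Suc k))"
    using kept at rmem_input_state[of "\<sigma> (Suc k)" n a b p] by (simp_all add: inputs_kept_def)
  define v where "v = (if 0 < b (\<sigma> (Suc k)) then p (\<sigma> (Suc k)) * b (\<sigma> (Suc k)) else 0)"
  define w where
    "w = (if 0 < a (\<sigma> (Suc k)) then v + (1 - p (\<sigma> (Suc k))) * a (\<sigma> (Suc k)) else v)"
  have exec: "exec eval_init s = s\<lparr>ireg := (ireg s)(1 := Suc k, 2 := n), rreg := (rreg s)(0 := w)\<rparr>"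
    using cells assms(2)
    by (simp add: eval_init_def incr_def a_at_def b_at_def p_at_def v_def w_def)
  have "w = gain a b p (\<sigma> (Suc k)) 0"
    using ab by (simp add: v_def w_def gain_def)
  then show ?thesis
    unfolding exec using assms(1) by (auto intro: eval_inv_cong)
qed

lemma exec_eval_step:
  assumes "eval_inv \<sigma> k s" "ireg s 1 = Suc k" "ireg s 2 = d" "1 \<le> d" "d \<le> n"
  shows "eval_inv \<sigma> k (exec eval_step s) \<and> ireg (exec eval_step s) 1 = Suc k \<and>
    ireg (exec eval_step s) 2 = d - 1 \<and> rreg (exec eval_step s) 0 =
      (if d = Suc k then rreg s 0 else upper_gain b p (\<sigma> d) (rreg s 0))"
proof -
  have kept: "inputs_kept s" and ord: "outputs_ordering s n \<sigma>"
    using assms(1) by (auto simp: eval_inv_def)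
  have range: "d \<in> {1..n}" using assms by simp
  note at = outputs_ordering_at[OF ord range]
  have cells: "ireg s 0 = n" "imem s d = \<sigma> d"
    "rmem s (n + \<sigma> d) = b (\<sigma> d)" "rmem s (n + n + \<sigma> d) = p (\<sigma> d)"
    using kept at rmem_input_state[of "\<sigma> d" n a b p] by (simp_all add: inputs_kept_def)
  define w where "w = (if d = Suc k then rreg s 0 else upper_gain b p (\<sigma> d) (rreg s 0))"
  have exec: "exec eval_step s = s\<lparr>ireg := (ireg s)(2 := d - 1), rreg := (rreg s)(0 := w)\<rparr>"
  proof (cases "d \<noteq> Suc k \<and> rreg s 0 < b (\<sigma> d)")
    case True
    then have "w = (1 - p (\<sigma> d)) * rreg s 0 + p (\<sigma> d) * b (\<sigma> d)"
      by (simp add: w_def upper_gain_def)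
    then show ?thesis
      using True cells assms(2,3)
      by (simp add: eval_step_def b_at_def p_at_def linorder_neq_iff[symmetric])
  next
    case False
    \<comment> \<open>Either the position is the one moved to the end, or the value has reached
      \<open>b\<close> and the upper gain is the identity.\<close>
    then have "w = rreg s 0"
      by (auto simp: w_def upper_gain_def algebra_simps)
    then show ?thesis
      using False cells assms(2,3) by (auto simp: eval_step_def b_at_def p_at_def)
  qed
  show ?thesis
    unfolding exec w_def[symmetric] using assms(1,2) by (auto intro: eval_inv_cong)
qed

lemma exec_eval_update:
  assumes "eval_inv \<sigma> k s" "ireg s 1 = Suc k" "k < n"
    and "rreg s 0 = candidate_value n a b p \<sigma> (Suc k)"
  shows "eval_inv \<sigma> (Suc k) (exec eval_update s) \<and> ireg (exec eval_update s) 1 = Suc k"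
proof -
  have best: "candidate_value n a b p \<sigma> i \<le> max (rreg s 1) (rreg s 0)" if "i \<in> {1..Suc k}" for i
    using assms(1,4) that by (cases "i = Suc k") (auto simp: eval_inv_def intro: max.coboundedI1)
  show ?thesis
  proof (cases "rreg s 1 < rreg s 0")
    case True
    then have "exec eval_update s
        = s\<lparr>rreg := (rreg s)(1 := rreg s 0), ireg := (ireg s)(3 := Suc k)\<rparr>"
      using assms(2) by (simp add: eval_update_def)
    then show ?thesis
      using assms True best by (simp add: eval_inv_def inputs_kept_def outputs_ordering_def)
  next
    case False
    then have "exec eval_update s = s"
      by (simp add: eval_update_def)
    then show ?thesis
      using assms False best by (simp add: eval_inv_def)
  qed
qed

lemma eval_row_halts:
  assumes "eval_inv \<sigma> k s" "ireg s 1 = k" "k < n" "\<forall>i\<in>{1..n}. a i \<le> b i"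
  shows "halts_within eval_row (max_steps eval_init + (Suc n * (4 + max_steps eval_step)
      + max_steps eval_update)) (\<lambda>s. eval_inv \<sigma> (Suc k) s \<and> ireg s 1 = Suc k) s"
proof -
  \<comment> \<open>The loop rule counts up while register 2 counts down, so \<open>m\<close> is the
    number of positions already processed. At \<open>m = n\<close> the fold is the candidate
    value.\<close>
  define I where "I m s \<longleftrightarrow> eval_inv \<sigma> k s \<and> ireg s 1 = Suc k \<and> ireg s 2 = n - m \<and>
      rreg s 0 = foldr (upper_gain b p) (map \<sigma> (filter (\<lambda>i. i \<noteq> Suc k) [Suc (n - m)..<Suc n]))
        (gain a b p (\<sigma> (Suc k)) 0)" for m s
  let ?q = "ILess (INum 0) (IReg 2)"
  let ?Q = "\<lambda>s. eval_inv \<sigma> (Suc k) s \<and> ireg s 1 = Suc k"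
  have loop: "halts_within (While ?q eval_step) (Suc (n - 0) * (1 + bcost ?q + max_steps eval_step))
      (I n) s" if "I 0 s" for s
    using that
  proof (rule halts_within_While)
    fix m s assume "m < n" "I m s"
    moreover have "[Suc (n - Suc m)..<Suc n] = (n - m) # [Suc (n - m)..<Suc n]"
      using \<open>m < n\<close> by (simp add: upt_conv_Cons Suc_diff_Suc del: upt_Suc)
    ultimately have "I (Suc m) (exec eval_step s)"
      using exec_eval_step[of \<sigma> k s "n - m"] by (auto simp: I_def simp del: upt_Suc)
    then have "halts_within eval_step (max_steps eval_step) (I (Suc m)) s"
      by (intro halts_within_exec) (auto simp: eval_step_def)
    then show "bval ?q s \<and> halts_within eval_step (max_steps eval_step) (I (Suc m)) s"
      using \<open>m < n\<close> \<open>I m s\<close> by (simp add: I_def)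
  qed (auto simp: I_def)
  have update: "halts_within eval_update (max_steps eval_update) ?Q s" if "I n s" for s
    using that exec_eval_update[of \<sigma> k s] assms(3)
    by (intro halts_within_exec) (auto simp: eval_update_def I_def candidate_value_def)
  have rest: "halts_within (While ?q eval_step) (Suc (n - 0) * (1 + bcost ?q + max_steps eval_step))
      (halts_within eval_update (max_steps eval_update) ?Q) s" if "I 0 s" for s
    using loop[OF that] by (rule halts_within_mono) (rule order.refl, rule update)
  have "I 0 (exec eval_init s)"
    using exec_eval_init[OF assms] by (simp add: I_def)
  then have "halts_within eval_init (max_steps eval_init)
      (halts_within (Seq (While ?q eval_step) eval_update)
        (Suc (n - 0) * (1 + bcost ?q + max_steps eval_step) + max_steps eval_update) ?Q) s"
    by (intro halts_within_exec halts_within_Seq rest) (auto simp: eval_init_def incr_def)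
  then have "halts_within eval_row (max_steps eval_init
      + (Suc (n - 0) * (1 + bcost ?q + max_steps eval_step) + max_steps eval_update)) ?Q s"
    unfolding eval_row_def by (rule halts_within_Seq)
  then show ?thesis by (rule halts_within_mono) (simp_all add: algebra_simps)
qed

lemma eval_prog_halts:
  assumes "inputs_kept s" "rreg s 1 = 0" "outputs_ordering s n \<sigma>"
    and "\<forall>i\<in>{1..n}. a i \<le> b i \<and> 0 \<le> p i \<and> p i \<le> 1"
  shows "halts_within eval_prog (4 + Suc n * (4 + (max_steps eval_init
      + (Suc n * (4 + max_steps eval_step) + max_steps eval_update)))) (eval_inv \<sigma> n) s"
proof -
  define I where "I k s \<longleftrightarrow> eval_inv \<sigma> k s \<and> ireg s 1 = k" for k s
  let ?q = "ILess (IReg 1) (IReg 0)"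
  let ?c = "Seq (SetIReg 1 (INum 0)) (SetIReg 3 (IReg 0))"
  let ?T = "max_steps eval_init + (Suc n * (4 + max_steps eval_step) + max_steps eval_update)"
  have loop: "halts_within (While ?q eval_row) (Suc (n - 0) * (1 + bcost ?q + ?T)) (I n) s"
    if "I 0 s" for s
    using that
  proof (rule halts_within_While)
    fix k s assume "k < n" "I k s"
    then have "halts_within eval_row ?T (I (Suc k)) s"
      using assms(4) by (intro halts_within_mono[OF eval_row_halts[of \<sigma> k s]]) (auto simp: I_def)
    then show "bval ?q s \<and> halts_within eval_row ?T (I (Suc k)) s"
      using \<open>k < n\<close> \<open>I k s\<close> by (simp add: I_def eval_inv_def inputs_kept_def)
  qed (auto simp: I_def eval_inv_def inputs_kept_def)
  have "0 \<le> candidate_value n a b p \<sigma> n" if "0 < n"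
    using assms(3,4) that by (intro candidate_value_nonneg) (auto simp: outputs_ordering_def)
  then have "I 0 (exec ?c s)"
    using assms(1-3) by (auto simp: I_def eval_inv_def inputs_kept_def outputs_ordering_def)
  then have "halts_within ?c (max_steps ?c)
      (halts_within (While ?q eval_row) (Suc (n - 0) * (1 + bcost ?q + ?T)) (I n)) s"
    by (intro halts_within_exec loop) auto
  then have "halts_within eval_prog (max_steps ?c + Suc (n - 0) * (1 + bcost ?q + ?T)) (I n) s"
    unfolding eval_prog_def by (rule halts_within_Seq)
  then show ?thesis
    by (rule halts_within_mono) (simp_all add: I_def algebra_simps)
qed

section \<open>Moving the best variable to the end\<close>

text \<open>The current position of the variable that started at \<open>i\<close> is
  \<open>m\<close>. Thus \<open>m = i\<close> gives \<open>\<sigma>\<close> itself and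
  \<open>m = n\<close> the ordering behind candidate \<open>i\<close>.\<close>

definition shifted :: "(nat \<Rightarrow> nat) \<Rightarrow> nat \<Rightarrow> nat \<Rightarrow> (nat \<Rightarrow> nat) \<Rightarrow> bool" where
  "shifted \<sigma> i m \<rho> \<longleftrightarrow> (\<forall>x\<in>{1..n}. \<rho> x =
     (if x < i then \<sigma> x else if x < m then \<sigma> (Suc x) else if x = m then \<sigma> i else \<sigma> x))"

lemma shift_prog_halts:
  assumes "inputs_kept s" "outputs_ordering s n \<sigma>" "ireg s 3 = i" "i \<le> n" "0 < n \<longrightarrow> 1 \<le> i"
  shows "halts_within shift_prog (Suc n * (4 + max_steps shift_step))
    (\<lambda>s. \<exists>\<rho>. outputs_ordering s n \<rho> \<and> shifted \<sigma> i n \<rho>) s"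
proof -
  define I where "I m s \<longleftrightarrow> inputs_kept s \<and> ireg s 3 = m \<and>
      (\<exists>\<rho>. outputs_ordering s n \<rho> \<and> shifted \<sigma> i m \<rho>)" for m s
  let ?q = "ILess (IReg 3) (IReg 0)"
  have init: "I i s"
    using assms unfolding I_def shifted_def by auto
  have "halts_within shift_prog (Suc (n - i) * (1 + bcost ?q + max_steps shift_step)) (I n) s"
    unfolding shift_prog_def using init \<open>i \<le> n\<close>
  proof (rule halts_within_While)
    fix m s assume m: "i \<le> m" "m < n" "I m s"
    then obtain \<rho> where \<rho>: "outputs_ordering s n \<rho>" "shifted \<sigma> i m \<rho>"
      unfolding I_def by blast
    let ?s = "exec shift_step s"
    have "imem ?s = (imem s)(m := imem s (Suc m), Suc m := imem s m)"
      using m by (simp add: shift_step_def swap_cells_def incr_def I_def)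
    then have "outputs_ordering ?s n (\<rho> \<circ> Transposition.transpose m (Suc m))"
      using m assms(5) by (intro outputs_ordering_swap[OF \<rho>(1)]) auto
    moreover have "shifted \<sigma> i (Suc m) (\<rho> \<circ> Transposition.transpose m (Suc m))"
      using \<rho>(2) m assms(5) by (auto simp: shifted_def Transposition.transpose_def)
    moreover have "inputs_kept ?s" "ireg ?s 3 = Suc m"
      using m by (auto simp: I_def inputs_kept_def shift_step_def swap_cells_def incr_def)
    ultimately have "I (Suc m) ?s"
      unfolding I_def by blast
    then have "halts_within shift_step (max_steps shift_step) (I (Suc m)) s"
      by (intro halts_within_exec) (auto simp: shift_step_def swap_cells_def incr_def)
    then show "bval ?q s \<and> halts_within shift_step (max_steps shift_step) (I (Suc m)) s"
      using m by (simp add: I_def inputs_kept_def)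
  qed (auto simp: I_def inputs_kept_def)
  then show ?thesis
  proof (rule halts_within_mono)
    show "Suc (n - i) * (1 + bcost ?q + max_steps shift_step)
        \<le> Suc n * (4 + max_steps shift_step)"
      by (intro mult_mono) auto
  qed (auto simp: I_def)
qed

section \<open>The whole program and its running time\<close>

text \<open>The sum is bracketed as the composition rule produces it. The quadratic terms come from
  the nested loops of sorting and evaluation.\<close>

definition ordering_time :: "nat \<Rightarrow> nat" where
  "ordering_time m = Suc m * (4 + max_steps init_step)
     + (2 + Suc m * (4 + (max_steps (Seq (incr 1) (SetIReg 2 (IReg 1)))
         + Suc m * (4 + max_steps sort_step)))
     + (4 + Suc m * (4 + (max_steps eval_init
         + (Suc m * (4 + max_steps eval_step) + max_steps eval_update)))
     + Suc m * (4 + max_steps shift_step)))"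

lemma ordering_prog_halts:
  assumes valid: "\<forall>i\<in>{1..n}. a i \<le> b i \<and> 0 \<le> p i \<and> p i \<le> 1"
  shows "halts_within ordering_prog (ordering_time n)
    (\<lambda>s. \<exists>\<rho>. outputs_ordering s n \<rho> \<and> (\<forall>\<tau>. \<tau> permutes {1..n} \<longrightarrow>
        stopping_value (joint_law n a b p) n \<tau> \<le> stopping_value (joint_law n a b p) n \<rho>))
    (input_state n a b p)"
    (is "halts_within _ _ ?Q _")
proof -
  \<comment> \<open>The phases are composed from the last to the first, each with the final
    postcondition \<open>?Q\<close>.\<close>
  have shift: "halts_within shift_prog (Suc n * (4 + max_steps shift_step)) ?Q s"
    if "eval_inv \<sigma> n s" "sorted_upto n b \<sigma> n 0" for s \<sigma>
  proof (rule halts_within_mono[OF shift_prog_halts])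
    show "inputs_kept s" "outputs_ordering s n \<sigma>" "ireg s 3 = ireg s 3" "ireg s 3 \<le> n"
      "0 < n \<longrightarrow> 1 \<le> ireg s 3"
      using that(1) by (auto simp: eval_inv_def)
    then have \<sigma>: "\<sigma> permutes {1..n}" by (simp add: outputs_ordering_def)
    fix s' assume "\<exists>\<rho>. outputs_ordering s' n \<rho> \<and> shifted \<sigma> (ireg s 3) n \<rho>"
    then obtain \<rho> where \<rho>: "outputs_ordering s' n \<rho>" "shifted \<sigma> (ireg s 3) n \<rho>" by blast
    have "stopping_value (joint_law n a b p) n \<tau> \<le> stopping_value (joint_law n a b p) n \<rho>"
      if \<tau>: "\<tau> permutes {1..n}" for \<tau>
    proof (cases "n = 0")
      case True
      then show ?thesis by (simp add: stopping_value_def value_from.simps)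
    next
      case False
      have "\<exists>i\<in>{1..n}. stopping_value (joint_law n a b p) n \<tau> \<le> candidate_value n a b p \<sigma> i"
        using False \<open>sorted_upto n b \<sigma> n 0\<close>
        by (intro stopping_value_le_candidate_value[OF valid \<sigma> \<tau>]) (auto simp: sorted_upto_def)
      then obtain i where i: "i \<in> {1..n}"
        and "stopping_value (joint_law n a b p) n \<tau> \<le> candidate_value n a b p \<sigma> i" by blast
      note this(2)
      also have "candidate_value n a b p \<sigma> i \<le> candidate_value n a b p \<sigma> (ireg s 3)"
        using \<open>eval_inv \<sigma> n s\<close> i False by (force simp: eval_inv_def)
      also have "\<dots> \<le> stopping_value (joint_law n a b p) n \<rho>"
        using valid \<sigma> \<rho> \<open>eval_inv \<sigma> n s\<close> False
        by (intro candidate_value_le_stopping_value)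
          (auto simp: outputs_ordering_def shifted_def eval_inv_def)
      finally show ?thesis .
    qed
    with \<rho>(1) show "?Q s'" by blast
  qed simp
  have eval: "halts_within (Seq eval_prog shift_prog) (4 + Suc n * (4 + (max_steps eval_init
        + (Suc n * (4 + max_steps eval_step) + max_steps eval_update)))
      + Suc n * (4 + max_steps shift_step)) ?Q s"
    if inv: "sort_inv n 0 s" for s
  proof -
    obtain \<sigma> where "inputs_kept s" "rreg s 1 = 0" "outputs_ordering s n \<sigma>"
      and sorted: "sorted_upto n b \<sigma> n 0"
      using inv unfolding sort_inv_def by blast
    from eval_prog_halts[OF this(1-3) valid] show ?thesis
      by (intro halts_within_Seq, elim halts_within_mono) (rule order.refl, rule shift[OF _ sorted])
  qed
  have sort: "halts_within (Seq sort_prog (Seq eval_prog shift_prog))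
      (2 + Suc n * (4 + (max_steps (Seq (incr 1) (SetIReg 2 (IReg 1)))
          + Suc n * (4 + max_steps sort_step)))
        + (4 + Suc n * (4 + (max_steps eval_init
          + (Suc n * (4 + max_steps eval_step) + max_steps eval_update)))
        + Suc n * (4 + max_steps shift_step))) ?Q s"
    if "inputs_kept s" "rreg s 1 = 0" "outputs_ordering s n id" for s
    using sort_prog_halts[OF that]
    by (intro halts_within_Seq, elim halts_within_mono) (rule order.refl, rule eval)
  show ?thesis
    unfolding ordering_prog_def ordering_time_def
    by (rule halts_within_Seq, rule halts_within_mono[OF init_prog_halts order.refl])
      (rule sort; blast)
qed

end

theorem theorem2:
  shows "\<exists>(prog :: com) (T :: nat \<Rightarrow> nat).
    (\<lambda>n. real (T n)) \<in> O(\<lambda>n. real n ^ 2) \<and>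
    (\<forall>(n :: nat) (a :: nat \<Rightarrow> real) (b :: nat \<Rightarrow> real) (p :: nat \<Rightarrow> real).
       (\<forall>i\<in>{1..n}. a i \<le> b i \<and> 0 \<le> p i \<and> p i \<le> 1) \<longrightarrow>
       (\<exists>t s \<sigma>. runs prog (input_state n a b p) t s \<and> t \<le> T n \<and>
          outputs_ordering s n \<sigma> \<and>
          (\<forall>\<tau>. \<tau> permutes {1..n} \<longrightarrow>
             stopping_value (joint_law n a b p) n \<tau> \<le> stopping_value (joint_law n a b p) n \<sigma>)))"
proof (rule exI[of _ ordering_prog], rule exI[of _ ordering_time], intro conjI allI impI)
  show "(\<lambda>n. real (ordering_time n)) \<in> O(\<lambda>n. real n ^ 2)"
    \<comment> \<open>Only sums, products and successors are pushed through \<open>real\<close>; the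
      \<open>max_steps\<close> terms remain opaque constants.\<close>
    unfolding ordering_time_def by (simp only: of_nat_add of_nat_mult of_nat_Suc) real_asymp
next
  fix n :: nat and a b p :: "nat \<Rightarrow> real"
  assume "\<forall>i\<in>{1..n}. a i \<le> b i \<and> 0 \<le> p i \<and> p i \<le> 1"
  from ordering_prog_halts[OF this]
  show "\<exists>t s \<sigma>. runs ordering_prog (input_state n a b p) t s \<and> t \<le> ordering_time n \<and>
      outputs_ordering s n \<sigma> \<and> (\<forall>\<tau>. \<tau> permutes {1..n} \<longrightarrow>
        stopping_value (joint_law n a b p) n \<tau> \<le> stopping_value (joint_law n a b p) n \<sigma>)"
    unfolding halts_within_def by blast
qed

end
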